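(* Let $c\in(0,+\infty)$. For each integer $N\ge 3$ let $k_0=k_0(N)$ be the optimal threshold and $v_N$ the value of the rank-based selection problem with $N$ applicants and cost of choice $c$, as defined in the context. Then the equation $$\log(x)=\Bigl(1+\frac{1}{2c}\Bigr)(x-1)$$ has a unique solution $\alpha$ in $(0,1)$, and, as $N\to\infty$, $\frac{k_0}{N}\to\alpha$ and $$\lim_{N\to\infty}v_N=1-c-\Bigl(c+\frac12\Bigr)\alpha-\frac{c\,\alpha}{1-\alpha}\log(\alpha).$$
   Context: Setting. $N$ applicants have i.i.d. values $X_1,\dots,X_N$, uniform on $[0,1]$, which are not observed. Only the relative ranks $R_k=\#\{1\le i\le k: X_i\ge X_k\}$ are observed, sequentially in $k$. Accepting an applicant with relative rank $1$ at time $t<N$ has conditional expected value $\frac{t}{t+1}$, and a cost of choice is subtracted. The expected cost of accepting at time $t$, evaluated at time $k\le t$ when nothing has been accepted before $k$, is $c\,\frac{N-t+1}{N-k+1}$. If nobody is accepted before time $N$, the last applicant must be taken, with expected payoff $\frac12-c$. Notation. For $1\le r\le s\le N$ put $$\tilde h(r,s)=\frac{s}{s+1}-c\,\frac{N-s+1}{N-r+1},\qquad h(r)=\tilde h(r,r)=\frac{r}{r+1}-c,$$ and for $1\le r\le N$ put $$Th(r)=\sum_{j=r+1}^{N-1}\frac{r}{j(j-1)}\,\tilde h(r,j)+\Bigl(1-\sum_{j=r+1}^{N-1}\frac{r}{j(j-1)}\Bigr)\Bigl(\frac12-c\Bigr),$$ where empty sums equal $0$. The threshold. $k_0=k_0(N)=\min\{1\le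 k\le N: h(s)\ge Th(s)\text{ for every integer } s\in[k,N]\}$. The grader's strategy is to accept the first applicant with relative rank $1$ at a time $\ge k_0$, or the last applicant if there is none. (For $N\ge 3$ one has $k_0\ge 2$.) The value. $v_N=v_N(k_0-1)$, where $v_N(k_0-1)=\max\{h(k_0-1),Th(k_0-1)\}$. This is the value obtained by passing over all applicants up to time $k_0-1$ and evaluating the problem at time $k_0-1$. *)

theory Defs
  imports Complex_Main
begin

text \<open>
  The rank-based selection problem with \<open>N\<close> applicants and cost of choice \<open>c\<close>.
  Times are natural numbers; the definitions are meaningful for \<open>1 \<le> r \<le> s \<le> N\<close>.
\<close>

definition h_tilde :: "real \<Rightarrow> nat \<Rightarrow> nat \<Rightarrow> nat \<Rightarrow> real" where
  "h_tilde c N r s =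
     real s / (real s + 1) - c * ((real N - real s + 1) / (real N - real r + 1))"

text \<open>Payoff for accepting at time \<open>r\<close> an applicant of relative rank 1.\<close>

definition accept_payoff :: "real \<Rightarrow> nat \<Rightarrow> nat \<Rightarrow> real" where
  "accept_payoff c N r = h_tilde c N r r"

text \<open>
  The operator \<open>T\<close> applied to the payoff: at time \<open>r\<close>, wait for the next applicant of relative
  rank 1. That applicant appears at time \<open>j\<close> with probability \<open>r / (j (j - 1))\<close>; if none appears
  before time \<open>N\<close>, the last applicant is taken.
\<close>

definition continue_payoff :: "real \<Rightarrow> nat \<Rightarrow> nat \<Rightarrow> real" where
  "continue_payoff c N r =
     (\<Sum>j = r + 1..N - 1. real r / (real j * (real j - 1)) * h_tilde c N r j)
     + (1 - (\<Sum>j = r + 1..N - 1. real r / (real j * (real j - 1)))) * (1 / 2 - c)"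

text \<open>For \<open>N \<ge> 1\<close> the set below contains \<open>N\<close>; for \<open>N = 0\<close> the threshold is unspecified.\<close>

definition threshold :: "real \<Rightarrow> nat \<Rightarrow> nat" where
  "threshold c N =
     Min {k \<in> {1..N}. \<forall>s \<in> {k..N}. accept_payoff c N s \<ge> continue_payoff c N s}"

definition value_at :: "real \<Rightarrow> nat \<Rightarrow> nat \<Rightarrow> real" where
  "value_at c N r = max (accept_payoff c N r) (continue_payoff c N r)"

text \<open>
  For \<open>N \<ge> 3\<close> and \<open>c > 0\<close> the threshold is at least 2, so the truncated subtraction yields a
  time \<open>\<ge> 1\<close>.
\<close>

definition game_value :: "real \<Rightarrow> nat \<Rightarrow> real" where
  "game_value c N = value_at c N (threshold c N - 1)"

end

theory Submission
  imports Defs "HOL-Analysis.Harmonic_Numbers" "HOL-Real_Asymp.Real_Asymp"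
begin

text \<open>
  Telescoping the sums in \<open>Th\<close> gives \<open>h(r) - Th(r) = r g(r)\<close>, where \<open>g\<close> is nondecreasing in \<open>r\<close> for
  each fixed \<open>N\<close>. Hence the times at which accepting is optimal form a final segment, and locating
  the threshold needs only the sign of \<open>h - Th\<close> at single points, with no uniformity in \<open>r\<close>. If
  \<open>r / N\<close> tends to \<open>x\<close> in \<open>(0, 1)\<close>, then \<open>h(r) - Th(r)\<close> tends to
  \<open>c x / (1 - x) (ln x - (1 + 1 / (2 c)) (x - 1))\<close>, which by concavity of \<open>ln\<close> changes sign exactly
  at \<open>\<alpha>\<close>. This limit vanishes at \<open>\<alpha>\<close>, so the game value has the same limit \<open>1 - c\<close> as \<open>h\<close>, and
  the stated formula also equals \<open>1 - c\<close> by the equation for \<open>\<alpha>\<close>.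
\<close>

section \<open>Secants of the logarithm through the point (1, 0)\<close>

text \<open>Cross-multiplied form of the fact that \<open>ln x / (1 - x)\<close>, minus the slope of
  the chord of \<open>ln\<close> from \<open>x\<close> to \<open>1\<close>, increases. By concavity
  the tangent at \<open>y\<close> lies strictly above \<open>ln\<close> at \<open>x\<close> and at
  \<open>1\<close>; with weights \<open>1 - y\<close> and \<open>y - x\<close> the right-hand sides
  of these two bounds cancel.\<close>

lemma ln_over_compl_strict_mono:
  fixes x y :: real
  assumes "0 < x" "x < y" "y < 1"
  shows "ln x * (1 - y) < ln y * (1 - x)"
proof -
  have "ln (x / y) < x / y - 1"
    using assms ln_le_minus_one[of "x / y"] ln_eq_minus_one[of "x / y"] by force
  then have "(ln x - ln y) * y < x - y"
    using assms by (simp add: ln_div field_simps)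
  then have a: "(ln x - ln y) * y * (1 - y) < (x - y) * (1 - y)"
    using assms by (intro mult_strict_right_mono) auto
  have "ln (1 / y) < 1 / y - 1"
    using assms ln_le_minus_one[of "1 / y"] ln_eq_minus_one[of "1 / y"] by force
  then have "- ln y * y < 1 - y"
    using assms by (simp add: ln_div field_simps)
  then have b: "- ln y * y * (y - x) < (1 - y) * (y - x)"
    using assms by (intro mult_strict_right_mono) auto
  have "y * (ln x * (1 - y)) < y * (ln y * (1 - x))"
    using a b by (simp add: algebra_simps)
  then show ?thesis
    using assms by simp
qed

lemma ln_secant_sign:
  fixes m x \<alpha> :: real
  assumes "0 < \<alpha>" "\<alpha> < 1" "ln \<alpha> = m * (\<alpha> - 1)" "0 < x" "x < 1"
  shows "x < \<alpha> \<Longrightarrow> ln x < m * (x - 1)" and "\<alpha> < x \<Longrightarrow> m * (x - 1) < ln x"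
proof -
  assume "x < \<alpha>"
  then have "ln x * (1 - \<alpha>) < m * (x - 1) * (1 - \<alpha>)"
    using ln_over_compl_strict_mono[of x \<alpha>] assms by (simp add: algebra_simps)
  then show "ln x < m * (x - 1)"
    using assms by simp
next
  assume "\<alpha> < x"
  then have "m * (x - 1) * (1 - \<alpha>) < ln x * (1 - \<alpha>)"
    using ln_over_compl_strict_mono[of \<alpha> x] assms by (simp add: algebra_simps)
  then show "m * (x - 1) < ln x"
    using assms by simp
qed

text \<open>At \<open>exp (- m)\<close> the logarithm equals \<open>- m\<close> and is below the
  line. The point \<open>1 / m\<close> maximizes \<open>ln x - m * (x - 1)\<close>; being less than
  \<open>1\<close>, it keeps the root away from the trivial one at \<open>1\<close>. A second root
  would contradict \<open>ln_secant_sign\<close>.\<close>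

lemma ex1_ln_secant:
  fixes m :: real
  assumes "m > 1"
  shows "\<exists>!\<alpha>::real. 0 < \<alpha> \<and> \<alpha> < 1 \<and> ln \<alpha> = m * (\<alpha> - 1)"
proof -
  let ?g = "\<lambda>x::real. ln x - m * (x - 1)"
  have lt: "exp (- m) < 1 / m"
  proof -
    have "m < exp m"
      using exp_ge_add_one_self[of m] by linarith
    then show ?thesis
      using assms by (simp add: exp_minus field_simps)
  qed
  have "ln m < m - 1"
    using assms ln_le_minus_one[of m] ln_eq_minus_one[of m] by force
  moreover have "m * (1 / m - 1) = 1 - m"
    using assms by (simp add: field_simps)
  ultimately have "?g (1 / m) \<ge> 0"
    using assms by (simp add: ln_div)
  moreover have "?g (exp (- m)) \<le> 0"
    using assms by (simp add: algebra_simps)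
  moreover have "continuous_on {exp (- m)..1 / m} ?g"
    by (intro continuous_intros) (auto dest: less_le_trans[OF exp_gt_zero])
  ultimately obtain \<alpha> where \<alpha>: "exp (- m) \<le> \<alpha>" "\<alpha> \<le> 1 / m" "?g \<alpha> = 0"
    using IVT'[of ?g "exp (- m)" 0 "1 / m"] lt by auto
  have pos: "0 < \<alpha>"
    using \<alpha>(1) less_le_trans[OF exp_gt_zero] by blast
  have lt1: "\<alpha> < 1"
    using \<alpha>(2) assms by (simp add: order.strict_trans1)
  have eq: "ln \<alpha> = m * (\<alpha> - 1)"
    using \<alpha>(3) by simp
  show ?thesis
  proof (rule ex1I[of _ \<alpha>])
    fix \<beta> :: real
    assume "0 < \<beta> \<and> \<beta> < 1 \<and> ln \<beta> = m * (\<beta> - 1)"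
    then show "\<beta> = \<alpha>"
      using ln_secant_sign[OF pos lt1 eq, of \<beta>] by (cases \<beta> \<alpha> rule: linorder_cases) auto
  qed (use pos lt1 eq in simp)
qed

section \<open>Closed form and monotonicity of the gain from accepting\<close>

lemma sum_record_prob:
  assumes "1 \<le> r" "r \<le> n"
  shows "(\<Sum>j = r + 1..n. real r / (real j * (real j - 1))) = 1 - real r / real n"
  using assms(2)
proof (induction n rule: dec_induct)
  case (step n)
  then have "real r / ((1 + real n) * real n) = real r / real n - real r / (1 + real n)"
    using assms(1) by (simp add: divide_simps) (simp add: algebra_simps)
  then show ?case
    using step by simp
qed (use assms in simp)

text \<open>Partial fractions: the rank part of a term is
  \<open>r / 2 * (1 / (j - 1) - 1 / (j + 1))\<close> and telescopes with step two; in the cost part,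
  \<open>(K + 1) / (j * (j - 1))\<close> telescopes and \<open>1 / (j - 1)\<close> leaves the
  harmonic sum. \<open>K\<close> and \<open>D\<close> stand for \<open>N\<close> and
  \<open>N - r + 1\<close>, kept fixed while \<open>n\<close> varies.\<close>

lemma sum_record_payoff:
  fixes K D c :: real
  assumes "1 \<le> r" "r \<le> n"
  shows "(\<Sum>j = r + 1..n. real r / (real j * (real j - 1)) *
            (real j / (real j + 1) - c * ((K - real j + 1) / D))) =
         real r / 2 * (1 / real r + 1 / (real r + 1) - 1 / real n - 1 / (real n + 1))
         - c * real r / D * ((K + 1) * (1 / real r - 1 / real n) - (\<Sum>i = r..<n. 1 / real i))"
  using assms(2)
proof (induction n rule: dec_induct)
  case (step n)
  have n: "real n > 0" using assms(1) step by simp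
  have a: "real r / ((1 + real n) * real n) * ((1 + real n) / (2 + real n)) =
      real r / 2 * (1 / real n - 1 / (2 + real n))"
    using n by (simp add: divide_simps)
  have b: "real r / ((1 + real n) * real n) * (c * ((K - real n) / D)) =
     c * real r / D * ((K + 1) * (1 / real n - 1 / (1 + real n)) - 1 / real n)"
    using n by (simp add: divide_simps)
  have "real r / ((1 + real n) * real n) * ((1 + real n) / (2 + real n) - c * ((K - real n) / D)) =
      real r / 2 * (1 / real n - 1 / (2 + real n))
      - c * real r / D * ((K + 1) * (1 / real n - 1 / (1 + real n)) - 1 / real n)"
    unfolding right_diff_distrib[of "real r / ((1 + real n) * real n)"] a b ..
  then show ?case
    using step by (simp add: algebra_simps)
qed (use assms in simp)

text \<open>This is \<open>(h(r) - Th(r)) / r\<close>, arranged to show its monotonicity: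
  subtracting \<open>1 / (N - 1)\<close> makes the summands positive and decreasing in
  \<open>i\<close>.\<close>

definition stop_gain :: "real \<Rightarrow> nat \<Rightarrow> nat \<Rightarrow> real" where
  "stop_gain c N r = 1 / (2 * real N) - 1 / (2 * (real r * (real r + 1)))
     - c * ((\<Sum>i = r..<N - 1. 1 / real i - 1 / (real N - 1)) / (real N - real r + 1))"

lemma accept_minus_continue:
  assumes "1 \<le> r" "r < N"
  shows "accept_payoff c N r - continue_payoff c N r = real r * stop_gain c N r"
proof -
  define S where "S = (\<Sum>i = r..<N - 1. 1 / real i)"
  define D where "D = real N - real r + 1"
  have N1: "real (N - 1) = real N - 1" using assms by (simp add: of_nat_diff)
  have pos: "real r > 0" "real N - 1 > 0" "D > 0" "real N > 0"
    using assms by (simp_all add: D_def)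
  have gain_sum: "(\<Sum>i = r..<N - 1. 1 / real i - 1 / (real N - 1)) =
      S - (real N - 1 - real r) / (real N - 1)"
    using assms by (simp add: S_def sum_subtractf of_nat_diff)
  have "(\<Sum>j = r + 1..N - 1. real r / (real j * (real j - 1)) * h_tilde c N r j) =
      real r / 2 * (1 / real r + 1 / (real r + 1) - 1 / (real N - 1) - 1 / real N)
      - c * real r / D * ((real N + 1) * (1 / real r - 1 / (real N - 1)) - S)"
    using sum_record_payoff[of r "N - 1" c "real N" D] assms
    unfolding h_tilde_def S_def D_def by (simp add: N1)
  then have cont: "continue_payoff c N r =
      real r / 2 * (1 / real r + 1 / (real r + 1) - 1 / (real N - 1) - 1 / real N)
      - c * real r / D * ((real N + 1) * (1 / real r - 1 / (real N - 1)) - S)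
      + (real r / (real N - 1) / 2 - c * (real r / (real N - 1)))"
    using sum_record_prob[of r "N - 1"] assms unfolding continue_payoff_def
    by (simp add: N1 right_diff_distrib)
  have acc: "accept_payoff c N r = real r / (real r + 1) - c"
    using pos(3) unfolding accept_payoff_def h_tilde_def D_def by simp
  \<comment> \<open>The difference is affine in \<open>c\<close>: \<open>rank\<close> is its
    constant part and \<open>cost\<close> its coefficient of \<open>c\<close>. In
    \<open>cost\<close>, \<open>- 1\<close> comes from accepting now and
    \<open>real r / (real N - 1)\<close> from being left with the last applicant.\<close>
  have rank: "real r / (real r + 1) -
      real r / 2 * (1 / real r + 1 / (real r + 1) - 1 / (real N - 1) - 1 / real N)
      - real r / (real N - 1) / 2 = real r * (1 / (2 * real N) - 1 / (2 * (real r * (real r + 1))))"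
    using pos by (simp add: divide_simps) (simp add: algebra_simps)
  have "real N = D + real r - 1" by (simp add: D_def)
  then have cost: "(real r / D * ((real N + 1) * (1 / real r - 1 / (real N - 1)) - S))
      - 1 + real r / (real N - 1) =
      - real r * ((S - (real N - 1 - real r) / (real N - 1)) / D)"
    using pos by (simp add: divide_simps) (simp add: algebra_simps)
  have "accept_payoff c N r - continue_payoff c N r =
      (real r / (real r + 1) -
      real r / 2 * (1 / real r + 1 / (real r + 1) - 1 / (real N - 1) - 1 / real N)
      - real r / (real N - 1) / 2) + c * ((real r / D * ((real N + 1) * (1 / real r - 1 / (real N - 1)) - S))
      - 1 + real r / (real N - 1))"
    unfolding acc cont by (simp add: algebra_simps)
  also have "\<dots> = real r * stop_gain c N r"
  proof -
    have "R * A + c * (- R * Y) = R * (A - c * Y)" for R A Y :: real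
      by (simp add: algebra_simps)
    then show ?thesis
      unfolding rank cost stop_gain_def gain_sum D_def[symmetric] .
  qed
  finally show ?thesis .
qed

text \<open>The cost term of the gain is an average of a decreasing sequence padded with two zeros, so
  it decreases when the leading, largest entry is dropped.\<close>

lemma stop_gain_Suc:
  assumes "c > 0" "1 \<le> r" "Suc r < N"
  shows "stop_gain c N r \<le> stop_gain c N (Suc r)"
proof -
  define a where "a i = 1 / real i - 1 / (real N - 1)" for i :: nat
  define B where "B = (\<Sum>i = Suc r..<N - 1. a i)"
  have a0: "a r \<ge> 0"
    using assms by (simp add: a_def field_simps)
  have "B \<le> real (card {Suc r..<N - 1}) * a r"
    unfolding B_def using assms by (intro sum_bounded_above) (auto simp: a_def frac_le)
  \<comment> \<open>The sum has only \<open>N - r - 2\<close> terms; the two extra copies of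
    \<open>a r\<close> account for the padding zeros.\<close>
  also have "\<dots> \<le> (real N - real r) * a r"
    using a0 assms by (intro mult_right_mono) (auto simp: of_nat_diff)
  finally have "B \<le> (real N - real r) * a r" .
  then have "B / (real N - real (Suc r) + 1) \<le> (a r + B) / (real N - real r + 1)"
    using assms by (simp add: divide_simps) (simp add: algebra_simps)
  then have "c * (B / (real N - real (Suc r) + 1)) \<le> c * ((a r + B) / (real N - real r + 1))"
    using assms(1) by (intro mult_left_mono) auto
  moreover have "(\<Sum>i = r..<N - 1. a i) = a r + B"
    unfolding B_def using assms by (simp add: sum.atLeast_Suc_lessThan)
  moreover have "1 / (2 * (real (Suc r) * (real (Suc r) + 1))) \<le> 1 / (2 * (real r * (real r + 1)))"
    using assms by (intro divide_left_mono mult_mono) auto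
  ultimately show ?thesis
    unfolding stop_gain_def a_def[symmetric] B_def[symmetric] by simp
qed

lemma stop_gain_mono:
  assumes "c > 0" "1 \<le> r" "r \<le> s" "s < N"
  shows "stop_gain c N r \<le> stop_gain c N s"
  using assms(3,4)
proof (induction s rule: dec_induct)
  case (step s)
  then show ?case
    using stop_gain_Suc[of c s N] assms by force
qed simp

section \<open>The stopping set and one-point tests for the threshold\<close>

lemma continue_le_accept_upward:
  assumes "c > 0" "1 \<le> r" "r \<le> s" "s \<le> N" "continue_payoff c N r \<le> accept_payoff c N r"
  shows "continue_payoff c N s \<le> accept_payoff c N s"
proof (cases "s = N")
  \<comment> \<open>At time \<open>N\<close> the sums are empty, and the claim is
    \<open>1 / 2 \<le> N / (N + 1)\<close>.\<close>
  case True
  then show ?thesis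
    using assms by (simp add: accept_payoff_def continue_payoff_def h_tilde_def field_simps)
next
  case False
  then have "s < N" using assms by simp
  have "0 \<le> real r * stop_gain c N r"
    using accept_minus_continue[of r N c] assms \<open>s < N\<close> by simp
  then have "0 \<le> stop_gain c N r"
    using assms by (simp add: zero_le_mult_iff)
  also have "\<dots> \<le> stop_gain c N s"
    using stop_gain_mono assms \<open>s < N\<close> by blast
  finally have "0 \<le> real s * stop_gain c N s" by simp
  then show ?thesis
    using accept_minus_continue[of s N c] assms \<open>s < N\<close> by simp
qed

text \<open>Upward closure turns the condition at the single time \<open>r\<close> into the
  condition on all of \<open>{r..N}\<close> required by \<open>threshold\<close>.\<close>

lemma threshold_le:
  assumes "c > 0" "1 \<le> r" "r \<le> N" "continue_payoff c N r \<le> accept_payoff c N r"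
  shows "threshold c N \<le> r"
  unfolding threshold_def using assms continue_le_accept_upward[OF assms(1,2)]
  by (intro Min_le) auto

lemma threshold_gt:
  assumes "r \<le> N" "N \<ge> 1" "accept_payoff c N r < continue_payoff c N r"
  shows "r < threshold c N"
proof -
  let ?A = "{k \<in> {1..N}. \<forall>s \<in> {k..N}. accept_payoff c N s \<ge> continue_payoff c N s}"
  \<comment> \<open>The set is nonempty, so its \<open>Min\<close> is a member.\<close>
  have "N \<in> ?A"
    using assms(2) by (auto simp: accept_payoff_def continue_payoff_def h_tilde_def field_simps)
  then have "threshold c N \<in> ?A"
    unfolding threshold_def by (intro Min_in) auto
  then show ?thesis
    using assms by (auto simp: not_less[symmetric])
qed

section \<open>Limits along times \<open>r N\<close> with \<open>r N / N\<close> tending to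
  \<open>x\<close>\<close>

text \<open>Each harmonic number is a logarithm plus a term tending to the Euler-Mascheroni
  constant; the constants cancel and \<open>- ln (r N / N)\<close> remains.\<close>

lemma harm_diff_LIMSEQ:
  assumes "filterlim r at_top sequentially" "(\<lambda>N. real (r N) / real N) \<longlonglongrightarrow> x" "x > 0"
  shows "(\<lambda>N. harm N - harm (r N) :: real) \<longlonglongrightarrow> - ln x"
proof -
  have "(\<lambda>N. (harm N - ln (real N)) - (harm (r N) - ln (real (r N))) - ln (real (r N) / real N))
     \<longlonglongrightarrow> euler_mascheroni - euler_mascheroni - ln x"
    using assms by (intro tendsto_diff tendsto_ln euler_mascheroni_LIMSEQ
      filterlim_compose[OF euler_mascheroni_LIMSEQ assms(1)]) auto
  moreover have "\<forall>\<^sub>F N in sequentially. (harm N - ln (real N)) - (harm (r N) - ln (real (r N)))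
       - ln (real (r N) / real N) = harm N - harm (r N)"
    using eventually_gt_at_top[of 0] filterlim_at_top[THEN iffD1, OF assms(1), rule_format, of 1]
    by eventually_elim (simp add: ln_div)
  ultimately show ?thesis
    by (simp add: tendsto_cong)
qed

text \<open>The sum runs from \<open>r\<close> to \<open>N - 2\<close>; the three fractions correct
  the end points so that \<open>harm_diff_LIMSEQ\<close> applies.\<close>

lemma sum_inverse_eq_harm:
  assumes "1 \<le> r" "r < N"
  shows "(\<Sum>i = r..<N - 1. 1 / real i) = harm N - harm r + 1 / real r - 1 / real N - 1 / (real N - 1)"
proof -
  obtain M where N: "N = Suc M" "r \<le> M"
    using assms by (cases N) auto
  have "(\<Sum>i = r..<M. 1 / real i) = harm M - harm r + 1 / real r - 1 / real M"
    using N(2)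
  proof (induction M rule: dec_induct)
    case (step n)
    then show ?case by (simp add: harm_Suc inverse_eq_divide)
  qed simp
  then show ?thesis
    by (simp add: N harm_Suc inverse_eq_divide)
qed

context
  fixes c x :: real and r :: "nat \<Rightarrow> nat"
  assumes x: "0 < x" "x < 1" and r: "(\<lambda>N. real (r N) / real N) \<longlonglongrightarrow> x"
begin

lemma eventually_index_bounds: "\<forall>\<^sub>F N in sequentially. 1 \<le> r N \<and> r N < N"
  using order_tendstoD(1)[OF r x(1)] order_tendstoD(2)[OF r x(2)] eventually_gt_at_top[of 0]
proof eventually_elim
  case (elim N)
  then show ?case by (cases "r N = 0") auto
qed

lemma index_at_top: "filterlim r at_top sequentially"
proof -
  have "filterlim (\<lambda>N. real (r N) / real N * real N) at_top sequentially"
    using filterlim_tendsto_pos_mult_at_top[OF r x(1) filterlim_real_sequentially] .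
  moreover have "\<forall>\<^sub>F N in sequentially. real (r N) / real N * real N = real (r N)"
    using eventually_gt_at_top[of 0] by eventually_elim simp
  ultimately have "filterlim (\<lambda>N. real (r N)) at_top sequentially"
    by (simp cong: filterlim_cong)
  then show ?thesis
    by (simp add: filterlim_sequentially_iff_filterlim_real)
qed

lemma inverse_index_LIMSEQ: "(\<lambda>N. 1 / real (r N)) \<longlonglongrightarrow> 0"
  using filterlim_compose[OF lim_1_over_n index_at_top] .

text \<open>In \<open>r * stop_gain\<close>, the rank part tends to \<open>x / 2\<close>, the factor
  \<open>r / (N - r + 1)\<close> to \<open>x / (1 - x)\<close>, and the sum to
  \<open>- ln x - (1 - x)\<close>. Used with floors of \<open>x * N\<close> to locate the threshold
  and with \<open>threshold c N - 1\<close> for the value.\<close>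

lemma accept_minus_continue_LIMSEQ:
  "(\<lambda>N. accept_payoff c N (r N) - continue_payoff c N (r N))
     \<longlonglongrightarrow> x / 2 + c * (x / (1 - x)) * (1 - x + ln x)"
proof -
  define q where "q N = real (r N) / real N" for N
  have q: "q \<longlonglongrightarrow> x" using r unfolding q_def .
  have n1: "(\<lambda>N. 1 / (real N - 1)) \<longlonglongrightarrow> 0" and n2: "(\<lambda>N. real N / (real N - 1)) \<longlonglongrightarrow> 1"
    by real_asymp+
  have r1: "(\<lambda>N. 1 / (real (r N) + 1)) \<longlonglongrightarrow> 0"
    using filterlim_compose[OF LIMSEQ_inverse_real_of_nat index_at_top]
    by (simp add: inverse_eq_divide add.commute)
  have "(\<lambda>N. - (1 / (real (r N) + 1)) / 2 + q N / 2 +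
       c * (q N / (1 - q N + 1 / real N)) *
         (1 - q N * (real N / (real N - 1)) -
           (harm N - harm (r N) + 1 / real (r N) - 1 / real N - 1 / (real N - 1))))
     \<longlonglongrightarrow> - 0 / 2 + x / 2 + c * (x / (1 - x + 0)) * (1 - x * 1 - (- ln x + 0 - 0 - 0))"
    using x by (intro tendsto_intros q r1 n1 n2 inverse_index_LIMSEQ lim_1_over_n
      harm_diff_LIMSEQ[OF index_at_top r]) auto
  moreover have "\<forall>\<^sub>F N in sequentially. - (1 / (real (r N) + 1)) / 2 + q N / 2 +
       c * (q N / (1 - q N + 1 / real N)) *
         (1 - q N * (real N / (real N - 1)) -
           (harm N - harm (r N) + 1 / real (r N) - 1 / real N - 1 / (real N - 1))) =
       accept_payoff c N (r N) - continue_payoff c N (r N)"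
    using eventually_index_bounds
  proof eventually_elim
    case (elim N)
    define S where "S = (\<Sum>i = r N..<N - 1. 1 / real i)"
    have pos: "real (r N) > 0" "real N - 1 > 0" "real N > 0" "real N - real (r N) + 1 > 0"
      using elim by auto
    have "(\<Sum>i = r N..<N - 1. 1 / real i - 1 / (real N - 1)) =
        S - real (N - 1 - r N) * (1 / (real N - 1))"
      unfolding S_def sum_subtractf by simp
    also have "real (N - 1 - r N) = real N - 1 - real (r N)"
      using elim by (simp add: of_nat_diff)
    also have "(real N - 1 - real (r N)) * (1 / (real N - 1)) = 1 - real (r N) / (real N - 1)"
      using pos by (simp add: field_simps)
    finally have S: "(\<Sum>i = r N..<N - 1. 1 / real i - 1 / (real N - 1)) =
        S - (1 - real (r N) / (real N - 1))" .
    have "q N / (1 - q N + 1 / real N) = real (r N) / (real N - real (r N) + 1)"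
      using pos by (simp add: q_def divide_simps)
    moreover have "q N * (real N / (real N - 1)) = real (r N) / (real N - 1)"
      using pos by (simp add: q_def)
    moreover have "accept_payoff c N (r N) - continue_payoff c N (r N) =
        - (1 / (real (r N) + 1)) / 2 + q N / 2 + c * (real (r N) / (real N - real (r N) + 1)) *
          (1 - real (r N) / (real N - 1) - S)"
    proof -
      have "real (r N) * (1 / (2 * real N) - 1 / (2 * (real (r N) * (real (r N) + 1)))) =
          - (1 / (real (r N) + 1)) / 2 + q N / 2"
        using pos by (simp add: q_def divide_simps) (simp add: algebra_simps)
      moreover have "R * (A - c * ((S - T) / D)) = R * A + c * (R / D) * (T - S)" for R A T D :: real
        by (simp add: algebra_simps diff_divide_distrib)
      ultimately show ?thesis
        unfolding accept_minus_continue[OF elim[THEN conjunct1] elim[THEN conjunct2]]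
          stop_gain_def S by metis
    qed
    ultimately show ?case
      using sum_inverse_eq_harm[of "r N" N] elim by (simp add: S_def)
  qed
  ultimately show ?thesis
    by (simp add: tendsto_cong)
qed

lemma accept_payoff_LIMSEQ: "(\<lambda>N. accept_payoff c N (r N)) \<longlonglongrightarrow> 1 - c"
proof -
  have "(\<lambda>N. 1 - 1 / (real (r N) + 1) - c) \<longlonglongrightarrow> 1 - 0 - c"
    using filterlim_compose[OF LIMSEQ_inverse_real_of_nat index_at_top]
    by (intro tendsto_intros) (simp add: inverse_eq_divide add.commute)
  moreover have "\<forall>\<^sub>F N in sequentially. 1 - 1 / (real (r N) + 1) - c = accept_payoff c N (r N)"
    using eventually_index_bounds
    by eventually_elim (simp add: accept_payoff_def h_tilde_def field_simps)
  ultimately show ?thesis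
    by (simp add: tendsto_cong)
qed

end

text \<open>Exposes the equation for \<alpha>: for \<open>0 < x\<close> the factor in front is
  positive, so the last bracket decides the sign.\<close>

lemma limit_gain_eq:
  fixes c x :: real
  assumes "c > 0" "x < 1"
  shows "x / 2 + c * (x / (1 - x)) * (1 - x + ln x) =
    c * (x / (1 - x)) * (ln x - (1 + 1 / (2 * c)) * (x - 1))"
  using assms by (simp add: divide_simps) (simp add: algebra_simps)

section \<open>Limits of the threshold and of the value\<close>

lemma threshold_LIMSEQ:
  fixes c \<alpha> :: real
  assumes c: "c > 0" and \<alpha>: "0 < \<alpha>" "\<alpha> < 1" "ln \<alpha> = (1 + 1 / (2 * c)) * (\<alpha> - 1)"
  shows "(\<lambda>N. real (threshold c N) / real N) \<longlonglongrightarrow> \<alpha>"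
proof -
  have floor_lim: "(\<lambda>N. real (nat \<lfloor>x * real N\<rfloor>) / real N) \<longlonglongrightarrow> x" if "x > 0" for x :: real
  proof -
    have "(\<lambda>N. of_int \<lfloor>x * real N\<rfloor> / real N) \<longlonglongrightarrow> x"
      by real_asymp
    then show ?thesis using that by simp
  qed
  note lim = accept_minus_continue_LIMSEQ[OF _ _ floor_lim, where c = c]
  have floor_le: "nat \<lfloor>x * real N\<rfloor> \<le> N" if "0 < x" "x < 1" for x :: real and N
  proof -
    have "x * real N \<le> real N" using that by (simp add: mult_left_le_one_le)
    then show ?thesis by (simp add: nat_le_iff) linarith
  qed
  have lower: "\<forall>\<^sub>F N in sequentially. y < real (threshold c N) / real N" if y: "y < \<alpha>" for y
  proof -
    \<comment> \<open>Clipping \<open>y\<close> at \<open>0\<close> keeps the midpoint strictly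
      between \<open>y\<close> and \<alpha> and inside the unit interval. Near time
      \<open>x * N\<close> waiting is eventually strictly better, so the threshold lies beyond
      it.\<close>
    define x where "x = (max y 0 + \<alpha>) / 2"
    have x: "0 < x" "x < \<alpha>" "x < 1" "y < x" using y \<alpha> by (auto simp: x_def)
    have "x / 2 + c * (x / (1 - x)) * (1 - x + ln x) < 0"
      unfolding limit_gain_eq[OF c x(3)] using ln_secant_sign(1)[OF \<alpha> x(1,3,2)] c x
      by (intro mult_pos_neg) auto
    then have "\<forall>\<^sub>F N in sequentially. accept_payoff c N (nat \<lfloor>x * real N\<rfloor>)
        - continue_payoff c N (nat \<lfloor>x * real N\<rfloor>) < 0"
      using order_tendstoD(2)[OF lim[OF x(1,3,1)]] by blast
    moreover have "\<forall>\<^sub>F N in sequentially. y < real (nat \<lfloor>x * real N\<rfloor>) / real N"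
      using order_tendstoD(1)[OF floor_lim[OF x(1)] x(4)] .
    ultimately show ?thesis
      using eventually_ge_at_top[of 1]
    proof eventually_elim
      case (elim N)
      then have "nat \<lfloor>x * real N\<rfloor> < threshold c N"
        using floor_le x by (intro threshold_gt) auto
      then have "real (nat \<lfloor>x * real N\<rfloor>) / real N \<le> real (threshold c N) / real N"
        by (intro divide_right_mono) auto
      then show ?case using elim by linarith
    qed
  qed
  have upper: "\<forall>\<^sub>F N in sequentially. real (threshold c N) / real N < y" if y: "\<alpha> < y" for y
  proof -
    define x where "x = (min y 1 + \<alpha>) / 2"
    have x: "0 < x" "\<alpha> < x" "x < 1" "x < y" using y \<alpha> by (auto simp: x_def)
    have "0 < x / 2 + c * (x / (1 - x)) * (1 - x + ln x)"
      unfolding limit_gain_eq[OF c x(3)] using ln_secant_sign(2)[OF \<alpha> x(1,3,2)] c x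
      by (intro mult_pos_pos) auto
    then have "\<forall>\<^sub>F N in sequentially. 0 < accept_payoff c N (nat \<lfloor>x * real N\<rfloor>)
        - continue_payoff c N (nat \<lfloor>x * real N\<rfloor>)"
      using order_tendstoD(1)[OF lim[OF x(1,3,1)]] by blast
    moreover have "\<forall>\<^sub>F N in sequentially. real (nat \<lfloor>x * real N\<rfloor>) / real N < y"
      using order_tendstoD(2)[OF floor_lim[OF x(1)] x(4)] .
    ultimately show ?thesis
      \<comment> \<open>Supplies \<open>1 \<le> nat \<lfloor>x * real N\<rfloor>\<close>, which
        \<open>threshold_le\<close> requires.\<close>
      using eventually_index_bounds[OF x(1,3) floor_lim[OF x(1)]]
    proof eventually_elim
      case (elim N)
      then have "threshold c N \<le> nat \<lfloor>x * real N\<rfloor>"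
        using c by (intro threshold_le) auto
      then have "real (threshold c N) / real N \<le> real (nat \<lfloor>x * real N\<rfloor>) / real N"
        by (intro divide_right_mono) auto
      then show ?case using elim by linarith
    qed
  qed
  show ?thesis
    using lower upper by (rule order_tendstoI)
qed

lemma game_value_LIMSEQ:
  fixes c \<alpha> :: real
  assumes c: "c > 0" and \<alpha>: "0 < \<alpha>" "\<alpha> < 1" "ln \<alpha> = (1 + 1 / (2 * c)) * (\<alpha> - 1)"
  shows "game_value c \<longlonglongrightarrow> 1 - c"
proof -
  let ?r = "\<lambda>N. threshold c N - 1"
  note t = threshold_LIMSEQ[OF assms]
  have "(\<lambda>N. real (threshold c N) / real N - 1 / real N) \<longlonglongrightarrow> \<alpha> - 0"
    by (intro tendsto_diff t lim_1_over_n)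
  moreover have "\<forall>\<^sub>F N in sequentially.
      real (threshold c N) / real N - 1 / real N = real (?r N) / real N"
    \<comment> \<open>The threshold is eventually at least \<open>1\<close>, so the truncated
      subtraction is exact.\<close>
    using eventually_index_bounds[OF \<alpha>(1,2) t]
    by eventually_elim (simp add: of_nat_diff diff_divide_distrib)
  ultimately have r: "(\<lambda>N. real (?r N) / real N) \<longlonglongrightarrow> \<alpha>"
    by (simp add: tendsto_cong)
  have acc: "(\<lambda>N. accept_payoff c N (?r N)) \<longlonglongrightarrow> 1 - c"
    using accept_payoff_LIMSEQ[OF \<alpha>(1,2) r] .
  have "\<alpha> / 2 + c * (\<alpha> / (1 - \<alpha>)) * (1 - \<alpha> + ln \<alpha>) = 0"
    by (subst limit_gain_eq[OF c \<alpha>(2)]) (simp add: \<alpha>(3))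
  then have "(\<lambda>N. accept_payoff c N (?r N) - continue_payoff c N (?r N)) \<longlonglongrightarrow> 0"
    using accept_minus_continue_LIMSEQ[OF \<alpha>(1,2) r, of c] by (simp only:)
  from tendsto_diff[OF acc this] have "(\<lambda>N. continue_payoff c N (?r N)) \<longlonglongrightarrow> 1 - c"
    by simp
  from tendsto_max[OF acc this] show ?thesis
    unfolding game_value_def value_at_def by simp
qed

theorem theorem3p4:
  fixes c :: real
  assumes "c > 0"
  shows "(\<exists>!\<alpha>::real. 0 < \<alpha> \<and> \<alpha> < 1 \<and> ln \<alpha> = (1 + 1 / (2 * c)) * (\<alpha> - 1)) \<and>
    (\<forall>\<alpha>::real. 0 < \<alpha> \<and> \<alpha> < 1 \<and> ln \<alpha> = (1 + 1 / (2 * c)) * (\<alpha> - 1) \<longrightarrow>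
       (\<lambda>N. real (threshold c N) / real N) \<longlonglongrightarrow> \<alpha> \<and>
       (\<lambda>N. game_value c N) \<longlonglongrightarrow>
         1 - c - (c + 1 / 2) * \<alpha> - c * \<alpha> / (1 - \<alpha>) * ln \<alpha>)"
proof (intro conjI allI impI; (elim conjE)?)
  show "\<exists>!\<alpha>::real. 0 < \<alpha> \<and> \<alpha> < 1 \<and> ln \<alpha> = (1 + 1 / (2 * c)) * (\<alpha> - 1)"
    using assms by (intro ex1_ln_secant) simp
next
  fix \<alpha> :: real
  assume \<alpha>: "0 < \<alpha>" "\<alpha> < 1" "ln \<alpha> = (1 + 1 / (2 * c)) * (\<alpha> - 1)"
  show "(\<lambda>N. real (threshold c N) / real N) \<longlonglongrightarrow> \<alpha>"
    using threshold_LIMSEQ[OF assms \<alpha>] .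
  \<comment> \<open>Inserting the equation for \<open>ln \<alpha>\<close> turns the last term into
    \<open>+ (c + 1 / 2) * \<alpha>\<close>, which cancels the preceding one.\<close>
  have "1 - c - (c + 1 / 2) * \<alpha> - c * \<alpha> / (1 - \<alpha>) * ln \<alpha> = 1 - c"
    unfolding \<alpha>(3) using assms \<alpha>(2) by (simp add: divide_simps) (simp add: algebra_simps)
  then show "(\<lambda>N. game_value c N) \<longlonglongrightarrow>
      1 - c - (c + 1 / 2) * \<alpha> - c * \<alpha> / (1 - \<alpha>) * ln \<alpha>"
    using game_value_LIMSEQ[OF assms \<alpha>] by (simp only:)
qed

end
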